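(* Let $X,Y$ be real Banach spaces. Assume that $X$ has $BDP$ and $Y$ has $BSCSP$. Then the projective tensor product $X\hat{\otimes}_{\pi}Y$ has $BSCSP$.
   Context: All Banach spaces are real; $B_Z$, $S_Z$ denote the closed unit ball and unit sphere of $Z$. $X\hat{\otimes}_\pi Y$ is the completion of the algebraic tensor product $X\otimes Y$ under the projective norm $\|u\|_\pi=\inf\{\sum_{i=1}^n\|x_i\|\|y_i\| : u=\sum_{i=1}^n x_i\otimes y_i\}$. A slice of $B_Z$ is a set $\{z\in B_Z: z^*(z)>1-\alpha\}$ with $z^*\in S_{Z^*}$, $0<\alpha<1$. $Z$ has $BDP$ (Ball Dentable Property) if $B_Z$ has slices of arbitrarily small diameter. $Z$ has $BSCSP$ (Ball Small Combination of Slice Property) if for every $\varepsilon>0$ there are slices $S_1,\dots,S_n$ of $B_Z$ and $\lambda_i\ge 0$ with $\sum_{i=1}^n\lambda_i=1$ such that $\sum_{i=1}^n\lambda_iS_i=\{\sum_{i=1}^n\lambda_iz_i: z_i\in S_i\}$ has diameter less than $\varepsilon$. *)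

theory Defs
  imports "HOL-Analysis.Analysis"
begin

section \<open>Dual functionals: the Hahn-Banach theorem for normed spaces\<close>

text \<open>A sublinear functional that is minimal for the pointwise order is linear; applied
  below a suitable functional dominated by the norm, this yields norming functionals.\<close>

definition sublinear :: "('a::real_vector \<Rightarrow> real) \<Rightarrow> bool" where
  "sublinear q \<longleftrightarrow> (\<forall>x y. q (x + y) \<le> q x + q y) \<and> (\<forall>c x. 0 \<le> c \<longrightarrow> q (c *\<^sub>R x) = c * q x)"

lemma sublinearI:
  assumes "\<And>x y. q (x + y) \<le> q x + q y"
    and "q 0 = 0" and "\<And>c x. 0 < c \<Longrightarrow> q (c *\<^sub>R x) \<le> c * q x"
  shows "sublinear q"
  unfolding sublinear_def
proof (intro conjI allI impI)
  fix c :: real and x assume c: "0 \<le> c"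
  show "q (c *\<^sub>R x) = c * q x"
  proof (cases "c = 0")
    case True
    then show ?thesis using assms(2) by simp
  next
    case False
    with c have c: "0 < c" by simp
    have "q (inverse c *\<^sub>R (c *\<^sub>R x)) \<le> inverse c * q (c *\<^sub>R x)"
      using assms(3)[of "inverse c" "c *\<^sub>R x"] c by simp
    then have "c * q x \<le> q (c *\<^sub>R x)" using c by (simp add: field_simps)
    with assms(3)[OF c, of x] show ?thesis by simp
  qed
qed (use assms(1) in blast)

lemma sublinear_add: "sublinear q \<Longrightarrow> q (x + y) \<le> q x + q y"
  and sublinear_scale: "sublinear q \<Longrightarrow> 0 \<le> c \<Longrightarrow> q (c *\<^sub>R x) = c * q x"
  by (auto simp: sublinear_def)

lemma sublinear_0: "sublinear q \<Longrightarrow> q 0 = 0"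
  using sublinear_scale[of q 0 0] by simp

lemma sublinear_minus: "sublinear q \<Longrightarrow> - q (- x) \<le> q x"
  using sublinear_add[of q x "- x"] sublinear_0[of q] by simp

text \<open>Lowering a sublinear functional in the direction \<open>z\<close>.\<close>

lemma sublinear_lower:
  fixes q :: "'a::real_vector \<Rightarrow> real"
  assumes q: "sublinear q" and ab: "a \<le> q z"  and az: "- q (- z) \<le> a"
  defines "r \<equiv> \<lambda>x. INF t\<in>{0..}. q (x + t *\<^sub>R z) - t * a"
  shows "sublinear r" "\<And>x. r x \<le> q x" "r (- z) \<le> - a"
proof -
  have lb: "- q (- x) \<le> q (x + t *\<^sub>R z) - t * a" if "0 \<le> t" for x t
  proof -
    have "t * a \<le> t * q z" using ab that by (rule mult_left_mono)
    also have "\<dots> = q (t *\<^sub>R z)" using q that by (simp add: sublinear_scale)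
    also have "\<dots> = q ((x + t *\<^sub>R z) + (- x))" by simp
    also have "\<dots> \<le> q (x + t *\<^sub>R z) + q (- x)" by (rule sublinear_add[OF q])
    finally show ?thesis by simp
  qed
  have bdd: "bdd_below ((\<lambda>t. q (x + t *\<^sub>R z) - t * a) ` {0..})" for x
    using lb by (intro bdd_belowI2[where m = "- q (- x)"]) auto
  have le: "r x \<le> q (x + t *\<^sub>R z) - t * a" if "0 \<le> t" for x t
    unfolding r_def using bdd that by (intro cINF_lower) auto
  have ge: "m \<le> r x" if "\<And>t. 0 \<le> t \<Longrightarrow> m \<le> q (x + t *\<^sub>R z) - t * a" for m x
    unfolding r_def using that by (intro cINF_greatest) auto
  show rq: "r x \<le> q x" for x using le[of 0 x] by simp
  show "r (- z) \<le> - a" using le[of 1 "- z"] sublinear_0[OF q] by simp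
  show "sublinear r"
  proof (rule sublinearI)
    fix x y
    have *: "r (x + y) \<le> (q (x + s *\<^sub>R z) - s * a) + (q (y + t *\<^sub>R z) - t * a)"
      if "0 \<le> s" "0 \<le> t" for s t
    proof -
      have "r (x + y) \<le> q ((x + y) + (s + t) *\<^sub>R z) - (s + t) * a" using that by (intro le) simp
      also have "(x + y) + (s + t) *\<^sub>R z = (x + s *\<^sub>R z) + (y + t *\<^sub>R z)"
        by (simp add: algebra_simps)
      also have "q \<dots> \<le> q (x + s *\<^sub>R z) + q (y + t *\<^sub>R z)" by (rule sublinear_add[OF q])
      finally show ?thesis by (simp add: algebra_simps)
    qed
    have "r (x + y) - (q (x + s *\<^sub>R z) - s * a) \<le> r y" if "0 \<le> s" for s
      using *[OF that] by (intro ge) (simp add: algebra_simps)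
    then have "r (x + y) - r y \<le> r x" by (intro ge) (simp add: algebra_simps)
    then show "r (x + y) \<le> r x + r y" by simp
  next
    have "0 \<le> r 0" using lb[of _ 0] sublinear_0[OF q] by (intro ge) simp
    with rq[of 0] show "r 0 = 0" using sublinear_0[OF q] by simp
  next
    fix c :: real and x assume c: "0 < c"
    have "r (c *\<^sub>R x) / c \<le> q (x + t *\<^sub>R z) - t * a" if "0 \<le> t" for t
    proof -
      have "r (c *\<^sub>R x) \<le> q (c *\<^sub>R x + (c * t) *\<^sub>R z) - (c * t) * a" using c that by (intro le) simp
      also have "c *\<^sub>R x + (c * t) *\<^sub>R z = c *\<^sub>R (x + t *\<^sub>R z)" by (simp add: algebra_simps)
      also have "q \<dots> = c * q (x + t *\<^sub>R z)" using c by (intro sublinear_scale[OF q]) simp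
      finally show ?thesis using c by (simp add: field_simps)
    qed
    then have "r (c *\<^sub>R x) / c \<le> r x" by (rule ge)
    then show "r (c *\<^sub>R x) \<le> c * r x" using c by (simp add: field_simps)
  qed
qed

lemma linear_below_sublinear:
  fixes p :: "'a::real_vector \<Rightarrow> real"
  assumes p: "sublinear p"
  obtains f where "linear f" "\<And>x. f x \<le> p x"
proof -
  define A where "A = {q. sublinear q \<and> (\<forall>x. q x \<le> p x)}"
  define P where "P = (\<lambda>f g :: 'a \<Rightarrow> real. \<forall>x. g x \<le> f x)"
  have "\<exists>m\<in>A. \<forall>a\<in>A. P m a \<longrightarrow> a = m"
  proof (rule predicate_Zorn)
    show "partial_order_on A (relation_of P A)"
    proof (rule partial_order_on_relation_ofI)
      show "P a c" if "P a b" "P b c" for a b c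
        using that unfolding P_def by (meson order.trans)
      show "P a a" for a by (simp add: P_def)
      show "a = b" if "P a b" "P b a" for a b
        using that unfolding P_def by (intro ext order.antisym) auto
    qed
    fix C assume C: "C \<in> Chains (relation_of P A)"
    have CA: "C \<subseteq> A" using C by (auto simp: Chains_def relation_of_def)
    have chain: "(\<forall>x. f x \<le> g x) \<or> (\<forall>x. g x \<le> f x)" if "f \<in> C" "g \<in> C" for f g
      using C that by (auto simp: Chains_def relation_of_def P_def)
    show "\<exists>u\<in>A. \<forall>a\<in>C. P a u"
    proof (cases "C = {}")
      case True
      then show ?thesis using p by (auto simp: A_def)
    next
      case False
      define u where "u = (\<lambda>x. INF q\<in>C. q x)"
      have bdd: "bdd_below ((\<lambda>q. q x) ` C)" for x
      proof (intro bdd_belowI2)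
        fix q assume "q \<in> C"
        then have q: "sublinear q" "q (- x) \<le> p (- x)" using CA by (auto simp: A_def)
        show "- p (- x) \<le> q x" using sublinear_minus[OF q(1), of x] q(2) by simp
      qed
      have le: "u x \<le> q x" if "q \<in> C" for q x
        unfolding u_def using bdd that by (rule cINF_lower)
      have ge: "m \<le> u x" if "\<And>q. q \<in> C \<Longrightarrow> m \<le> q x" for m x
        unfolding u_def using False that by (rule cINF_greatest)
      have "sublinear u"
      proof (rule sublinearI)
        fix x y
        have *: "u (x + y) \<le> f x + g y" if fg: "f \<in> C" "g \<in> C" for f g
        proof -
          obtain h where h: "h \<in> C" "h x \<le> f x" "h y \<le> g y"
            using chain[OF fg] fg by blast
          then have "sublinear h" using CA by (auto simp: A_def)
          then show ?thesis using le[OF h(1), of "x + y"] sublinear_add[of h x y] h by linarith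
        qed
        have "u (x + y) - f x \<le> u y" if "f \<in> C" for f
          using *[OF that] by (intro ge) (simp add: algebra_simps)
        then have "u (x + y) - u y \<le> u x" by (intro ge) (simp add: algebra_simps)
        then show "u (x + y) \<le> u x + u y" by simp
      next
        have "q 0 = 0" if "q \<in> C" for q using that CA by (auto simp: A_def intro: sublinear_0)
        then have "(\<lambda>q. q 0) ` C = {0}" using False by (auto simp: image_def)
        then show "u 0 = 0" by (simp add: u_def)
      next
        fix c :: real and x assume c: "0 < c"
        have "u (c *\<^sub>R x) / c \<le> q x" if "q \<in> C" for q
        proof -
          have "sublinear q" using that CA by (auto simp: A_def)
          then have "q (c *\<^sub>R x) = c * q x" using c by (intro sublinear_scale) auto
          then show ?thesis using le[OF that, of "c *\<^sub>R x"] c by (simp add: field_simps)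
        qed
        then have "u (c *\<^sub>R x) / c \<le> u x" by (rule ge)
        then show "u (c *\<^sub>R x) \<le> c * u x" using c by (simp add: field_simps)
      qed
      moreover have "u x \<le> p x" for x
      proof -
        obtain q where q: "q \<in> C" using False by blast
        then have "q x \<le> p x" using CA by (auto simp: A_def)
        with le[OF q, of x] show ?thesis by linarith
      qed
      ultimately have "u \<in> A" by (simp add: A_def)
      then show ?thesis using le by (auto simp: P_def)
    qed
  qed
  then obtain f where f: "f \<in> A" and min: "\<And>g. g \<in> A \<Longrightarrow> (\<And>x. g x \<le> f x) \<Longrightarrow> g = f"
    by (auto simp: P_def)
  have sub: "sublinear f" and fp: "\<And>x. f x \<le> p x" using f by (auto simp: A_def)
  have neg: "f (- z) = - f z" for z
  proof -
    define r where "r = (\<lambda>x. INF t\<in>{0..}. f (x + t *\<^sub>R z) - t * f z)"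
    have r: "sublinear r" "\<And>x. r x \<le> f x" "r (- z) \<le> - f z"
      using sublinear_lower[of f "f z" z, OF sub order.refl sublinear_minus[OF sub]]
      unfolding r_def by blast+
    have "r x \<le> p x" for x using r(2)[of x] fp[of x] by linarith
    then have "r \<in> A" using r(1) by (simp add: A_def)
    then have "r = f" using min r(2) by blast
    then show ?thesis using r(3) sublinear_minus[OF sub, of z] by simp
  qed
  have "linear f"
  proof (rule linearI)
    show "f (x + y) = f x + f y" for x y
      using sublinear_add[OF sub, of x y] sublinear_add[OF sub, of "- x" "- y"]
        neg[of x] neg[of y] neg[of "x + y"] by simp
    show "f (c *\<^sub>R x) = c *\<^sub>R f x" for c x
    proof (cases "0 \<le> c")
      case True
      then show ?thesis using sublinear_scale[OF sub] by simp
    next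
      case False
      then have "f ((- c) *\<^sub>R x) = (- c) * f x" by (intro sublinear_scale[OF sub]) simp
      then show ?thesis using neg[of "c *\<^sub>R x"] by simp
    qed
  qed
  then show ?thesis using fp that by blast
qed

lemma norming_functional:
  fixes z :: "'a::real_normed_vector"
  obtains f :: "'a \<Rightarrow>\<^sub>L real" where "norm f \<le> 1" "f z = norm z"
proof -
  have n: "sublinear (norm :: 'a \<Rightarrow> real)"
    by (simp add: sublinear_def norm_triangle_ineq)
  define p where "p = (\<lambda>x. INF t\<in>{0..}. norm (x + t *\<^sub>R z) - t * norm z)"
  have p: "sublinear p" "\<And>x. p x \<le> norm x" "p (- z) \<le> - norm z"
    using sublinear_lower[of norm "norm z" z, OF n order.refl sublinear_minus[OF n]]
    unfolding p_def by blast+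
  obtain f where f: "linear f" "\<And>x. f x \<le> p x" using linear_below_sublinear[OF p(1)] by blast
  have le: "f x \<le> norm x" for x using f(2) p(2) order.trans by blast
  have abs: "\<bar>f x\<bar> \<le> norm x" for x
    using le[of x] le[of "- x"] by (simp add: linear_neg[OF f(1)])
  have bl: "bounded_linear f"
    using f(1) abs by (intro bounded_linear_intro[where K = 1])
      (auto simp: linear_add linear_scale)
  have app: "Blinfun f x = f x" for x by (simp add: bounded_linear_Blinfun_apply[OF bl])
  show ?thesis
  proof (rule that[of "Blinfun f"])
    show "norm (Blinfun f) \<le> 1" using abs by (intro norm_blinfun_bound) (auto simp: app)
    have "f (- z) \<le> - norm z" using f(2)[of "- z"] p(3) by simp
    then show "Blinfun f z = norm z"
      using le[of z] by (simp add: app linear_neg[OF f(1)])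
  qed
qed

lemma functionals_separate:
  fixes z :: "'a::real_normed_vector"
  assumes "\<And>f :: 'a \<Rightarrow>\<^sub>L real. f z = 0"
  shows "z = 0"
proof -
  obtain f :: "'a \<Rightarrow>\<^sub>L real" where "norm f \<le> 1" "f z = norm z" by (rule norming_functional)
  then show ?thesis using assms[of f] by simp
qed


section \<open>Completion of a normed space\<close>

text \<open>The completion of \<open>Z\<close> is realised as the closure of the canonical image of \<open>Z\<close> in its
  bidual; the lemmas \<open>norm_to_completion\<close> and \<open>closure_range_to_completion\<close> together with the instance
  \<open>banach\<close> say that this is a Banach space containing \<open>Z\<close> isometrically as a dense subspace.\<close>

definition canonical :: "'a::real_normed_vector \<Rightarrow> (('a \<Rightarrow>\<^sub>L real) \<Rightarrow>\<^sub>L real)" where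
  "canonical z = Blinfun (\<lambda>f. blinfun_apply f z)"

lemma canonical_apply [simp]: "canonical z f = f z"
  unfolding canonical_def by (simp add: bounded_linear_Blinfun_apply blinfun.bounded_linear_left)

lemma norm_canonical [simp]: "norm (canonical z) = norm z"
proof (rule antisym)
  show "norm (canonical z) \<le> norm z"
    by (rule norm_blinfun_bound) (auto simp: norm_blinfun mult.commute[of "norm z"] simp del: real_norm_def)
  obtain f :: "'a \<Rightarrow>\<^sub>L real" where f: "norm f \<le> 1" "f z = norm z" by (rule norming_functional)
  have "norm z \<le> norm (canonical z f)" using f by simp
  also have "\<dots> \<le> norm (canonical z) * norm f" by (rule norm_blinfun)
  also have "\<dots> \<le> norm (canonical z) * 1" using f by (intro mult_left_mono) auto
  finally show "norm z \<le> norm (canonical z)" by simp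
qed

lemma linear_canonical: "linear canonical"
  by (rule linearI) (auto intro!: blinfun_eqI simp: blinfun.bilinear_simps)

lemma subspace_closure_canonical: "subspace (closure (range canonical))"
  unfolding subspace_def
proof (intro conjI ballI allI)
  have "canonical 0 \<in> closure (range canonical)" by (intro subsetD[OF closure_subset] rangeI)
  then show "0 \<in> closure (range canonical)" by (simp add: linear_0[OF linear_canonical])
  fix u and c :: real assume u: "u \<in> closure (range (canonical :: 'a \<Rightarrow> _))"
  then obtain a where a: "\<And>n. a n \<in> range (canonical :: 'a \<Rightarrow> _)" "a \<longlonglongrightarrow> u"
    by (auto simp: closure_sequential)
  have "c *\<^sub>R a n \<in> range canonical" for n
    using a(1)[of n] by (auto simp: linear_scale[OF linear_canonical, symmetric])
  moreover have "(\<lambda>n. c *\<^sub>R a n) \<longlonglongrightarrow> c *\<^sub>R u" using a(2) by (intro tendsto_intros)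
  ultimately show "c *\<^sub>R u \<in> closure (range canonical)"
    unfolding closure_sequential by (intro exI conjI allI)
  fix v assume "v \<in> closure (range (canonical :: 'a \<Rightarrow> _))"
  then obtain b where b: "\<And>n. b n \<in> range (canonical :: 'a \<Rightarrow> _)" "b \<longlonglongrightarrow> v"
    by (auto simp: closure_sequential)
  have "a n + b n \<in> range canonical" for n
    using a(1)[of n] b(1)[of n] by (auto simp: linear_add[OF linear_canonical, symmetric])
  moreover have "(\<lambda>n. a n + b n) \<longlonglongrightarrow> u + v" using a(2) b(2) by (intro tendsto_intros)
  ultimately show "u + v \<in> closure (range canonical)"
    unfolding closure_sequential by (intro exI conjI allI)
qed

typedef (overloaded) 'a completion =
  "closure (range (canonical :: 'a::real_normed_vector \<Rightarrow> _))"
  by (rule exI[of _ 0]) (rule subspace_0[OF subspace_closure_canonical])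

setup_lifting type_definition_completion

instantiation completion :: (real_normed_vector) real_normed_vector
begin

lift_definition zero_completion :: "'a completion" is 0
  by (rule subspace_0[OF subspace_closure_canonical])

lift_definition plus_completion :: "'a completion \<Rightarrow> 'a completion \<Rightarrow> 'a completion" is "(+)"
  by (rule subspace_add[OF subspace_closure_canonical])

lift_definition minus_completion :: "'a completion \<Rightarrow> 'a completion \<Rightarrow> 'a completion" is "(-)"
  by (rule subspace_diff[OF subspace_closure_canonical])

lift_definition uminus_completion :: "'a completion \<Rightarrow> 'a completion" is uminus
  by (rule subspace_neg[OF subspace_closure_canonical])

lift_definition scaleR_completion :: "real \<Rightarrow> 'a completion \<Rightarrow> 'a completion" is "(*\<^sub>R)"
  by (rule subspace_scale[OF subspace_closure_canonical])

lift_definition norm_completion :: "'a completion \<Rightarrow> real" is norm .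

definition dist_completion :: "'a completion \<Rightarrow> 'a completion \<Rightarrow> real"
  where "dist_completion u v = norm (u - v)"

definition sgn_completion :: "'a completion \<Rightarrow> 'a completion"
  where "sgn_completion u = scaleR (inverse (norm u)) u"

definition [code del]:
  "(uniformity :: ('a completion \<times> 'a completion) filter) =
     (INF e\<in>{0 <..}. principal {(x, y). dist x y < e})"

definition open_completion :: "'a completion set \<Rightarrow> bool"
  where [code del]:
    "open_completion S = (\<forall>x\<in>S. \<forall>\<^sub>F (x', y) in uniformity. x' = x \<longrightarrow> y \<in> S)"

instance
  by standard
    (rule dist_completion_def sgn_completion_def uniformity_completion_def open_completion_def
      | (transfer, simp add: algebra_simps norm_triangle_ineq))+

end

lemma dist_Rep_completion: "dist u v = dist (Rep_completion u) (Rep_completion v)"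
  unfolding dist_norm by transfer (rule refl)

instance completion :: (real_normed_vector) banach
proof
  fix X :: "nat \<Rightarrow> 'a completion" assume X: "Cauchy X"
  have "Cauchy (\<lambda>n. Rep_completion (X n))"
    using X by (simp add: Cauchy_def dist_Rep_completion)
  then obtain L where L: "(\<lambda>n. Rep_completion (X n)) \<longlonglongrightarrow> L"
    by (auto simp: Cauchy_convergent_iff convergent_def)
  moreover have "Rep_completion (X n) \<in> closure (range canonical)" for n by (rule Rep_completion)
  ultimately have "L \<in> closure (range canonical)"
    using closed_sequentially[OF closed_closure, of "\<lambda>n. Rep_completion (X n)"] by simp
  then have "L = Rep_completion (Abs_completion L)" by (simp add: Abs_completion_inverse)
  then have "X \<longlonglongrightarrow> Abs_completion L"
    using L by (simp add: lim_sequentially dist_Rep_completion)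
  then show "convergent X" by (auto simp: convergent_def)
qed

lift_definition to_completion :: "'a::real_normed_vector \<Rightarrow> 'a completion" is canonical
  by (intro subsetD[OF closure_subset] rangeI)

lemma linear_to_completion: "linear to_completion"
  by (rule linearI; transfer; simp add: linear_add[OF linear_canonical] linear_scale[OF linear_canonical])

lemma norm_to_completion [simp]: "norm (to_completion z) = norm z"
  by transfer simp

lemma closure_range_to_completion: "closure (range (to_completion :: 'a::real_normed_vector \<Rightarrow> _)) = UNIV"
proof (intro UNIV_eq_I[symmetric])
  fix u :: "'a completion"
  have "dist (to_completion z) u = dist (canonical z) (Rep_completion u)" for z
    unfolding dist_norm by transfer (rule refl)
  moreover have "Rep_completion u \<in> closure (range canonical)" by (rule Rep_completion)
  ultimately show "u \<in> closure (range to_completion)"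
    unfolding closure_approachable by auto
qed


section \<open>The algebraic tensor product\<close>

text \<open>As in Ryan's textbook, \<open>x \<otimes> y\<close> is the functional \<open>B \<mapsto> B x y\<close> on the space of all bilinear
  forms on \<open>X \<times> Y\<close>, and the tensor product is the set of finite sums of such functionals
  (the value on functions that are not bilinear is set to 0, so that equality of tensors is
  equality on bilinear forms).  No continuity is involved.  The universal property is
  \<open>alg_tensor_universal\<close>.\<close>

typedef (overloaded) ('a::real_vector, 'b::real_vector) alg_tensor =
  "{u :: ('a \<Rightarrow> 'b \<Rightarrow> real) \<Rightarrow> real.
     \<exists>xys. u = (\<lambda>B. if bilinear B then \<Sum>(x, y)\<leftarrow>xys. B x y else 0)}"
  by blast

setup_lifting type_definition_alg_tensor

lemma sum_list_prod_scale:
  assumes "\<And>x y. g (h x) y = c * (g x y :: real)"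
  shows "(\<Sum>(x, y)\<leftarrow>map (\<lambda>(x, y). (h x, y)) xys. g x y) = c * (\<Sum>(x, y)\<leftarrow>xys. g x y)"
  by (induction xys) (auto simp: assms algebra_simps)

lemma bilinear_scale1: "bilinear B \<Longrightarrow> B (c *\<^sub>R x) y = c * (B x y :: real)"
  using bilinear_lmul[of B c x y] by simp

instantiation alg_tensor :: (real_vector, real_vector) real_vector
begin

lift_definition zero_alg_tensor :: "('a, 'b) alg_tensor" is "\<lambda>_. 0"
  by (rule exI[of _ "[]"]) auto

lift_definition plus_alg_tensor :: "('a, 'b) alg_tensor \<Rightarrow> ('a, 'b) alg_tensor \<Rightarrow> ('a, 'b) alg_tensor"
  is "\<lambda>u v B. u B + v B"
proof -
  fix u v :: "('a \<Rightarrow> 'b \<Rightarrow> real) \<Rightarrow> real"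
  assume "\<exists>xys. u = (\<lambda>B. if bilinear B then \<Sum>(x, y)\<leftarrow>xys. B x y else 0)"
    and "\<exists>xys. v = (\<lambda>B. if bilinear B then \<Sum>(x, y)\<leftarrow>xys. B x y else 0)"
  then obtain us vs where "u = (\<lambda>B. if bilinear B then \<Sum>(x, y)\<leftarrow>us. B x y else 0)"
    and "v = (\<lambda>B. if bilinear B then \<Sum>(x, y)\<leftarrow>vs. B x y else 0)" by blast
  then show "\<exists>xys. (\<lambda>B. u B + v B) = (\<lambda>B. if bilinear B then \<Sum>(x, y)\<leftarrow>xys. B x y else 0)"
    by (intro exI[of _ "us @ vs"]) (auto simp: fun_eq_iff)
qed

lift_definition scaleR_alg_tensor :: "real \<Rightarrow> ('a, 'b) alg_tensor \<Rightarrow> ('a, 'b) alg_tensor"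
  is "\<lambda>c u B. c * u B"
proof -
  fix c :: real and u :: "('a \<Rightarrow> 'b \<Rightarrow> real) \<Rightarrow> real"
  assume "\<exists>xys. u = (\<lambda>B. if bilinear B then \<Sum>(x, y)\<leftarrow>xys. B x y else 0)"
  then obtain us where us: "u = (\<lambda>B. if bilinear B then \<Sum>(x, y)\<leftarrow>us. B x y else 0)" by blast
  have "(\<Sum>(x, y)\<leftarrow>map (\<lambda>(x, y). (c *\<^sub>R x, y)) us. B x y) = c * (\<Sum>(x, y)\<leftarrow>us. B x y)"
    if "bilinear B" for B
    by (rule sum_list_prod_scale) (rule bilinear_scale1[OF that])
  then show "\<exists>xys. (\<lambda>B. c * u B) = (\<lambda>B. if bilinear B then \<Sum>(x, y)\<leftarrow>xys. B x y else 0)"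
    using us by (intro exI[of _ "map (\<lambda>(x, y). (c *\<^sub>R x, y)) us"]) (auto simp: fun_eq_iff)
qed

definition uminus_alg_tensor :: "('a, 'b) alg_tensor \<Rightarrow> ('a, 'b) alg_tensor"
  where "uminus_alg_tensor u = (- 1) *\<^sub>R u"

definition minus_alg_tensor :: "('a, 'b) alg_tensor \<Rightarrow> ('a, 'b) alg_tensor \<Rightarrow> ('a, 'b) alg_tensor"
  where "minus_alg_tensor u v = u + (- 1) *\<^sub>R v"

instance
  by standard
    (simp only: uminus_alg_tensor_def minus_alg_tensor_def
      | (transfer, simp add: fun_eq_iff algebra_simps))+

end

lift_definition tensor :: "'a::real_vector \<Rightarrow> 'b::real_vector \<Rightarrow> ('a, 'b) alg_tensor" (infixl "\<otimes>\<^sub>t" 75)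
  is "\<lambda>x y B. if bilinear B then B x y else 0"
proof -
  fix x :: 'a and y :: 'b
  show "\<exists>xys. (\<lambda>B. if bilinear B then B x y else 0) =
      (\<lambda>B. if bilinear B then \<Sum>(x, y)\<leftarrow>xys. B x y else (0::real))"
    by (rule exI[of _ "[(x, y)]"]) auto
qed

lemma Rep_sum_tensor:
  "Rep_alg_tensor (\<Sum>(x, y)\<leftarrow>xys. x \<otimes>\<^sub>t y) = (\<lambda>B. if bilinear B then \<Sum>(x, y)\<leftarrow>xys. B x y else 0)"
  by (induction xys)
    (auto simp: zero_alg_tensor.rep_eq plus_alg_tensor.rep_eq tensor.rep_eq fun_eq_iff)

lemma sum_tensor_eq_iff:
  "(\<Sum>(x, y)\<leftarrow>us. x \<otimes>\<^sub>t y) = (\<Sum>(x, y)\<leftarrow>vs. x \<otimes>\<^sub>t y) \<longleftrightarrow>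
     (\<forall>B :: _ \<Rightarrow> _ \<Rightarrow> real. bilinear B \<longrightarrow> (\<Sum>(x, y)\<leftarrow>us. B x y) = (\<Sum>(x, y)\<leftarrow>vs. B x y))"
  by (auto simp: Rep_alg_tensor_inject[symmetric] Rep_sum_tensor fun_eq_iff)

lemma alg_tensor_rep: obtains xys where "u = (\<Sum>(x, y)\<leftarrow>xys. x \<otimes>\<^sub>t y)"
proof -
  obtain xys where "Rep_alg_tensor u = (\<lambda>B. if bilinear B then \<Sum>(x, y)\<leftarrow>xys. B x y else 0)"
    using Rep_alg_tensor[of u] by blast
  then have "u = (\<Sum>(x, y)\<leftarrow>xys. x \<otimes>\<^sub>t y)"
    by (simp only: Rep_alg_tensor_inject[symmetric] Rep_sum_tensor)
  then show ?thesis by (rule that)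
qed

lemma bilinear_tensor: "bilinear (\<otimes>\<^sub>t)"
  unfolding bilinear_def
  by (intro conjI allI linearI; transfer;
      auto simp: fun_eq_iff bilinear_ladd bilinear_radd bilinear_lmul bilinear_rmul)

lemma linear_sum_list: "linear f \<Longrightarrow> f (\<Sum>(x, y)\<leftarrow>xys. g x y) = (\<Sum>(x, y)\<leftarrow>xys. f (g x y))"
  by (induction xys) (auto simp: linear_0 linear_add)

lemma alg_tensor_universal:
  fixes B :: "'a::real_vector \<Rightarrow> 'b::real_vector \<Rightarrow> 'c::real_vector"
  assumes B: "bilinear B"
  shows "\<exists>!L. linear L \<and> (\<forall>x y. L (x \<otimes>\<^sub>t y) = B x y)"
proof (rule ex_ex1I)
  define rep where "rep u = (SOME xys. u = (\<Sum>(x, y)\<leftarrow>xys. x \<otimes>\<^sub>t y))" for u :: "('a, 'b) alg_tensor"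
  have rep: "u = (\<Sum>(x, y)\<leftarrow>rep u. x \<otimes>\<^sub>t y)" for u
    unfolding rep_def by (rule someI_ex) (meson alg_tensor_rep)
  define L where "L u = (\<Sum>(x, y)\<leftarrow>rep u. B x y)" for u
  have L: "L (\<Sum>(x, y)\<leftarrow>us. x \<otimes>\<^sub>t y) = (\<Sum>(x, y)\<leftarrow>us. B x y)" for us
  proof -
    define vs where "vs = rep (\<Sum>(x, y)\<leftarrow>us. x \<otimes>\<^sub>t y)"
    define d where "d = (\<Sum>(x, y)\<leftarrow>vs. B x y) - (\<Sum>(x, y)\<leftarrow>us. B x y)"
    have eq: "(\<Sum>(x, y)\<leftarrow>us. x \<otimes>\<^sub>t y) = (\<Sum>(x, y)\<leftarrow>vs. x \<otimes>\<^sub>t y)"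
      unfolding vs_def by (rule rep)
    have d0: "f d = 0" if f: "linear f" for f :: "'c \<Rightarrow> real"
    proof -
      have "bilinear (\<lambda>x y. f (B x y))"
        using B f by (auto simp: bilinear_def intro: linear_compose[unfolded o_def])
      then have "(\<Sum>(x, y)\<leftarrow>us. f (B x y)) = (\<Sum>(x, y)\<leftarrow>vs. f (B x y))"
        using eq[unfolded sum_tensor_eq_iff] by blast
      then show ?thesis by (simp add: d_def linear_diff[OF f] linear_sum_list[OF f])
    qed
    have "d = 0"
    proof (rule ccontr)
      assume "d \<noteq> 0"
      then have "independent {d}" by (simp add: dependent_single)
      then obtain f :: "'c \<Rightarrow> real" where "linear f" "\<forall>x\<in>{d}. f x = 1"
        using linear_independent_extend[of "{d}" "\<lambda>_. 1"] by blast
      then show False using d0[of f] by simp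
    qed
    then show ?thesis by (simp add: L_def d_def vs_def)
  qed
  have "linear L"
  proof (rule linearI)
    fix u v :: "('a, 'b) alg_tensor" and c :: real
    obtain us where us: "u = (\<Sum>(x, y)\<leftarrow>us. x \<otimes>\<^sub>t y)" by (rule alg_tensor_rep)
    obtain vs where vs: "v = (\<Sum>(x, y)\<leftarrow>vs. x \<otimes>\<^sub>t y)" by (rule alg_tensor_rep)
    show "L (u + v) = L u + L v"
      using L[of "us @ vs"] by (simp add: us vs L)
    have 1: "(\<Sum>(x, y)\<leftarrow>map (\<lambda>(x, y). (c *\<^sub>R x, y)) us. x \<otimes>\<^sub>t y) = c *\<^sub>R u"
      unfolding us by (induction us) (auto simp: bilinear_lmul[OF bilinear_tensor] scaleR_add_right)
    have 2: "(\<Sum>(x, y)\<leftarrow>map (\<lambda>(x, y). (c *\<^sub>R x, y)) us. B x y) = c *\<^sub>R (\<Sum>(x, y)\<leftarrow>us. B x y)"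
      by (induction us) (auto simp: bilinear_lmul[OF B] scaleR_add_right)
    show "L (c *\<^sub>R u) = c *\<^sub>R L u"
      using L[of "map (\<lambda>(x, y). (c *\<^sub>R x, y)) us"] unfolding 1 2 by (simp add: us L)
  qed
  moreover have "L (x \<otimes>\<^sub>t y) = B x y" for x y using L[of "[(x, y)]"] by simp
  ultimately show "\<exists>L. linear L \<and> (\<forall>x y. L (x \<otimes>\<^sub>t y) = B x y)" by blast
next
  fix L M :: "('a, 'b) alg_tensor \<Rightarrow> 'c"
  assume L: "linear L \<and> (\<forall>x y. L (x \<otimes>\<^sub>t y) = B x y)"
    and M: "linear M \<and> (\<forall>x y. M (x \<otimes>\<^sub>t y) = B x y)"
  show "L = M"
  proof
    fix u :: "('a, 'b) alg_tensor"
    obtain us where us: "u = (\<Sum>(x, y)\<leftarrow>us. x \<otimes>\<^sub>t y)" by (rule alg_tensor_rep)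
    show "L u = M u" unfolding us using L M by (simp add: linear_sum_list)
  qed
qed


section \<open>The projective norm and the projective tensor product\<close>

lemma tensor_zero_if_functionals_zero:
  fixes xys :: "('a::real_normed_vector \<times> 'b::real_vector) list"
  assumes "\<And>f :: 'a \<Rightarrow>\<^sub>L real. (\<Sum>(x, y)\<leftarrow>xys. f x *\<^sub>R y) = 0"
  shows "(\<Sum>(x, y)\<leftarrow>xys. x \<otimes>\<^sub>t y) = 0"
  using assms
proof (induction "length xys" arbitrary: xys)
  case 0
  then show ?case by simp
next
  case (Suc n)
  then obtain a b zs where xys: "xys = (a, b) # zs" by (metis length_Suc_conv surj_pair)
  have len: "n = length zs" using Suc.hyps(2) xys by simp
  have hyp: "f a *\<^sub>R b + (\<Sum>(x, y)\<leftarrow>zs. f x *\<^sub>R y) = 0" for f :: "'a \<Rightarrow>\<^sub>L real"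
    using Suc.prems[of f] by (simp add: xys)
  show ?case
  proof (cases "a = 0")
    case True
    then have "(\<Sum>(x, y)\<leftarrow>zs. x \<otimes>\<^sub>t y) = 0"
      using hyp by (intro Suc.hyps(1)[OF len]) (auto simp: blinfun.zero_right)
    then show ?thesis by (simp add: xys True bilinear_lzero[OF bilinear_tensor])
  next
    case False
    then obtain g :: "'a \<Rightarrow>\<^sub>L real" where g: "g a \<noteq> 0" using functionals_separate by blast
    define k where "k = (\<lambda>x. g x / g a)"
    have ga: "g x = g a * k x" for x using g by (simp add: k_def)
    have "g a *\<^sub>R (b + (\<Sum>(x, y)\<leftarrow>zs. k x *\<^sub>R y)) = g a *\<^sub>R b + (\<Sum>(x, y)\<leftarrow>zs. g x *\<^sub>R y)"
    proof -
      have "(\<Sum>(x, y)\<leftarrow>zs. g x *\<^sub>R y) = g a *\<^sub>R (\<Sum>(x, y)\<leftarrow>zs. k x *\<^sub>R y)"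
      proof (induction zs)
        case (Cons z zs)
        show ?case
          using ga[of "fst z"] Cons.IH by (simp add: case_prod_beta scaleR_add_right)
      qed simp
      then show ?thesis by (simp add: scaleR_add_right)
    qed
    then have b: "b = - (\<Sum>(x, y)\<leftarrow>zs. k x *\<^sub>R y)"
      using hyp[of g] g by (simp add: eq_neg_iff_add_eq_0)
    define ws where "ws = map (\<lambda>(x, y). (x - k x *\<^sub>R a, y)) zs"
    have shift: "(\<Sum>(x, y)\<leftarrow>ws. C x y) = (\<Sum>(x, y)\<leftarrow>zs. C x y) + C a b"
      if C: "bilinear C" for C :: "'a \<Rightarrow> 'b \<Rightarrow> 'd::real_vector"
    proof -
      have "(\<Sum>(x, y)\<leftarrow>ws. C x y) = (\<Sum>(x, y)\<leftarrow>zs. C x y) - C a (\<Sum>(x, y)\<leftarrow>zs. k x *\<^sub>R y)"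
        unfolding ws_def
        by (induction zs)
          (auto simp: bilinear_rzero[OF C] bilinear_lsub[OF C] bilinear_lmul[OF C]
            bilinear_radd[OF C] bilinear_rmul[OF C])
      then show ?thesis unfolding b by (simp add: bilinear_rneg[OF C])
    qed
    have "(\<Sum>(x, y)\<leftarrow>ws. x \<otimes>\<^sub>t y) = 0"
    proof (rule Suc.hyps(1))
      show "n = length ws" by (simp add: ws_def len)
      fix f :: "'a \<Rightarrow>\<^sub>L real"
      have "bilinear (\<lambda>x (y::'b). f x *\<^sub>R y)"
        unfolding bilinear_def
        by (intro conjI allI linearI) (auto simp: blinfun.bilinear_simps algebra_simps)
      from shift[OF this] show "(\<Sum>(x, y)\<leftarrow>ws. f x *\<^sub>R y) = 0"
        using hyp[of f] by (simp add: add.commute)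
    qed
    then show ?thesis using shift[OF bilinear_tensor] by (simp add: xys add.commute)
  qed
qed

definition proj_cost :: "('a::real_normed_vector \<times> 'b::real_normed_vector) list \<Rightarrow> real" where
  "proj_cost xys = (\<Sum>(x, y)\<leftarrow>xys. norm x * norm y)"

lemma proj_cost_nonneg [simp]: "0 \<le> proj_cost xys"
  unfolding proj_cost_def by (intro sum_list_nonneg) auto

definition proj_norm :: "('a::real_normed_vector, 'b::real_normed_vector) alg_tensor \<Rightarrow> real" where
  "proj_norm u = Inf {proj_cost xys |xys. u = (\<Sum>(x, y)\<leftarrow>xys. x \<otimes>\<^sub>t y)}"

lemma proj_norm_le: "u = (\<Sum>(x, y)\<leftarrow>xys. x \<otimes>\<^sub>t y) \<Longrightarrow> proj_norm u \<le> proj_cost xys"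
  unfolding proj_norm_def by (rule cInf_lower) (auto intro!: bdd_belowI[of _ 0])

lemma proj_norm_ge:
  "(\<And>xys. u = (\<Sum>(x, y)\<leftarrow>xys. x \<otimes>\<^sub>t y) \<Longrightarrow> m \<le> proj_cost xys) \<Longrightarrow> m \<le> proj_norm u"
  unfolding proj_norm_def by (rule cInf_greatest) (use alg_tensor_rep[of u] in blast)+

lemma proj_norm_nonneg: "0 \<le> proj_norm u"
  by (rule proj_norm_ge) simp

lemma proj_norm_triangle: "proj_norm (u + v) \<le> proj_norm u + proj_norm v"
proof -
  have *: "proj_norm (u + v) \<le> proj_cost us + proj_cost vs"
    if "u = (\<Sum>(x, y)\<leftarrow>us. x \<otimes>\<^sub>t y)" "v = (\<Sum>(x, y)\<leftarrow>vs. x \<otimes>\<^sub>t y)" for us vs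
    using proj_norm_le[of "u + v" "us @ vs"] that by (simp add: proj_cost_def)
  have "proj_norm (u + v) - proj_cost us \<le> proj_norm v"
    if "u = (\<Sum>(x, y)\<leftarrow>us. x \<otimes>\<^sub>t y)" for us
  proof (rule proj_norm_ge)
    show "proj_norm (u + v) - proj_cost us \<le> proj_cost vs"
      if "v = (\<Sum>(x, y)\<leftarrow>vs. x \<otimes>\<^sub>t y)" for vs
      using *[OF \<open>u = _\<close> that] by simp
  qed
  then have "proj_norm (u + v) - proj_norm v \<le> proj_norm u"
    by (intro proj_norm_ge) (simp add: algebra_simps)
  then show ?thesis by simp
qed

lemma proj_norm_scaleR_le: "proj_norm (c *\<^sub>R u) \<le> \<bar>c\<bar> * proj_norm u"
proof (cases "c = 0")
  case True
  then show ?thesis using proj_norm_le[of 0 "[]"] by (simp add: proj_cost_def)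
next
  case False
  have "proj_norm (c *\<^sub>R u) / \<bar>c\<bar> \<le> proj_cost us" if us: "u = (\<Sum>(x, y)\<leftarrow>us. x \<otimes>\<^sub>t y)" for us
  proof -
    have 1: "c *\<^sub>R u = (\<Sum>(x, y)\<leftarrow>map (\<lambda>(x, y). (c *\<^sub>R x, y)) us. x \<otimes>\<^sub>t y)"
      unfolding us by (induction us) (auto simp: bilinear_lmul[OF bilinear_tensor] scaleR_add_right)
    have 2: "proj_cost (map (\<lambda>(x, y). (c *\<^sub>R x, y)) us) = \<bar>c\<bar> * proj_cost us"
      unfolding proj_cost_def by (induction us) (auto simp: algebra_simps)
    show ?thesis using proj_norm_le[OF 1] False unfolding 2 by (simp add: field_simps)
  qed
  then have "proj_norm (c *\<^sub>R u) / \<bar>c\<bar> \<le> proj_norm u" by (rule proj_norm_ge)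
  then show ?thesis using False by (simp add: field_simps)
qed

lemma proj_norm_eq_0_imp:
  fixes u :: "('a::real_normed_vector, 'b::real_normed_vector) alg_tensor"
  assumes "proj_norm u = 0"
  shows "u = 0"
proof -
  obtain us where us: "u = (\<Sum>(x, y)\<leftarrow>us. x \<otimes>\<^sub>t y)" by (rule alg_tensor_rep)
  have "(\<Sum>(x, y)\<leftarrow>us. f x *\<^sub>R y) = 0" for f :: "'a \<Rightarrow>\<^sub>L real"
  proof (rule functionals_separate)
    fix g :: "'b \<Rightarrow>\<^sub>L real"
    let ?B = "\<lambda>x y. f x * g y"
    have B: "bilinear ?B"
      unfolding bilinear_def
      by (intro conjI allI linearI) (auto simp: blinfun.bilinear_simps algebra_simps)
    define s where "s = (\<Sum>(x, y)\<leftarrow>us. ?B x y)"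
    define K where "K = norm f * norm g + 1"
    have K: "0 < K" unfolding K_def by (intro add_nonneg_pos) auto
    have "\<bar>s\<bar> / K \<le> proj_cost vs" if vs: "u = (\<Sum>(x, y)\<leftarrow>vs. x \<otimes>\<^sub>t y)" for vs
    proof -
      have "s = (\<Sum>(x, y)\<leftarrow>vs. ?B x y)"
        using us vs B sum_tensor_eq_iff[of us vs] unfolding s_def by blast
      moreover have "\<bar>\<Sum>(x, y)\<leftarrow>vs. ?B x y\<bar> \<le> K * proj_cost vs"
      proof (induction vs)
        case Nil
        then show ?case by (simp add: proj_cost_def)
      next
        case (Cons z vs)
        obtain x y where z: "z = (x, y)" by fastforce
        have "\<bar>?B x y\<bar> \<le> (norm f * norm x) * (norm g * norm y)"
          unfolding abs_mult using norm_blinfun[of f x] norm_blinfun[of g y]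
          by (intro mult_mono) auto
        also have "\<dots> \<le> K * (norm x * norm y)" by (simp add: K_def algebra_simps)
        finally show ?case using Cons.IH by (simp add: z proj_cost_def algebra_simps)
      qed
      ultimately show ?thesis using K by (simp add: field_simps)
    qed
    then have "\<bar>s\<bar> / K \<le> proj_norm u" by (rule proj_norm_ge)
    then have "s = 0" using assms K by (simp add: field_simps)
    then show "g (\<Sum>(x, y)\<leftarrow>us. f x *\<^sub>R y) = 0"
      using linear_sum_list[of "blinfun_apply g" "\<lambda>x y. f x *\<^sub>R y" us]
      by (simp add: s_def blinfun.scaleR_right bounded_linear.linear[OF blinfun.bounded_linear_right])
  qed
  then show ?thesis unfolding us by (rule tensor_zero_if_functionals_zero)
qed

instantiation alg_tensor :: (real_normed_vector, real_normed_vector) real_normed_vector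
begin

definition norm_alg_tensor :: "('a, 'b) alg_tensor \<Rightarrow> real"
  where "norm_alg_tensor = proj_norm"

definition dist_alg_tensor :: "('a, 'b) alg_tensor \<Rightarrow> ('a, 'b) alg_tensor \<Rightarrow> real"
  where "dist_alg_tensor u v = norm (u - v)"

definition sgn_alg_tensor :: "('a, 'b) alg_tensor \<Rightarrow> ('a, 'b) alg_tensor"
  where "sgn_alg_tensor u = scaleR (inverse (norm u)) u"

definition [code del]:
  "(uniformity :: (('a, 'b) alg_tensor \<times> ('a, 'b) alg_tensor) filter) =
     (INF e\<in>{0 <..}. principal {(x, y). dist x y < e})"

definition open_alg_tensor :: "('a, 'b) alg_tensor set \<Rightarrow> bool"
  where [code del]:
    "open_alg_tensor S = (\<forall>x\<in>S. \<forall>\<^sub>F (x', y) in uniformity. x' = x \<longrightarrow> y \<in> S)"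

instance
proof
  fix u v :: "('a, 'b) alg_tensor" and c :: real
  show "norm u = 0 \<longleftrightarrow> u = 0"
    unfolding norm_alg_tensor_def
  proof
    assume "u = 0"
    then have "proj_norm u \<le> 0" using proj_norm_le[of u "[]"] by (simp add: proj_cost_def)
    then show "proj_norm u = 0" using proj_norm_nonneg[of u] by simp
  qed (rule proj_norm_eq_0_imp)
  show "norm (u + v) \<le> norm u + norm v"
    unfolding norm_alg_tensor_def by (rule proj_norm_triangle)
  show "norm (c *\<^sub>R u) = \<bar>c\<bar> * norm u"
    unfolding norm_alg_tensor_def
  proof (cases "c = 0")
    case True
    then show "proj_norm (c *\<^sub>R u) = \<bar>c\<bar> * proj_norm u"
      using proj_norm_scaleR_le[of c u] proj_norm_nonneg[of "c *\<^sub>R u"] by simp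
  next
    case False
    then have "proj_norm u \<le> proj_norm (c *\<^sub>R u) / \<bar>c\<bar>"
      using proj_norm_scaleR_le[of "inverse c" "c *\<^sub>R u"] by (simp add: field_simps)
    then show "proj_norm (c *\<^sub>R u) = \<bar>c\<bar> * proj_norm u"
      using False proj_norm_scaleR_le[of c u] by (simp add: field_simps)
  qed
qed (rule dist_alg_tensor_def sgn_alg_tensor_def uniformity_alg_tensor_def open_alg_tensor_def)+

end

type_synonym ('a, 'b) projective_tensor = "('a, 'b) alg_tensor completion"


section \<open>Slices of the unit ball, BDP and BSCSP\<close>

definition is_slice :: "'z::real_normed_vector set \<Rightarrow> bool" where
  "is_slice S \<longleftrightarrow> (\<exists>(f :: 'z \<Rightarrow>\<^sub>L real) \<alpha>. norm f = 1 \<and> 0 < \<alpha> \<and> \<alpha> < 1 \<and>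
     S = {z \<in> cball 0 1. blinfun_apply f z > 1 - \<alpha>})"

text \<open>Both properties belong to a space, i.e. to a type, passed as \<open>TYPE('z)\<close>.\<close>

definition BDP :: "'z::banach itself \<Rightarrow> bool" where
  "BDP _ \<longleftrightarrow> (\<forall>\<epsilon>>0. \<exists>S :: 'z set. is_slice S \<and> diameter S < \<epsilon>)"

definition BSCSP :: "'z::banach itself \<Rightarrow> bool" where
  "BSCSP _ \<longleftrightarrow> (\<forall>\<epsilon>>0. \<exists>(n::nat) (S :: nat \<Rightarrow> 'z set) (l :: nat \<Rightarrow> real).
     (\<forall>i<n. is_slice (S i)) \<and> (\<forall>i<n. 0 \<le> l i) \<and> (\<Sum>i<n. l i) = 1 \<and>
     diameter {\<Sum>i<n. l i *\<^sub>R z i |z. \<forall>i<n. z i \<in> S i} < \<epsilon>)"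

end

theory Submission
  imports Defs
begin

text \<open>
  Let \<open>f\<close> be a norm-one functional on \<open>X\<close> whose slice \<open>{x. f x > 1 - \<alpha>}\<close> of the ball has diameter
  below \<open>\<delta>\<close>, let \<open>x\<^sub>0\<close> be a point of that slice and put \<open>c = 2 / \<alpha>\<close>.  The ball of \<open>X\<close> is pointed at
  \<open>x\<^sub>0\<close> in the quantitative sense that
  \<open>\<parallel>x - f x x\<^sub>0\<parallel> + c \<bar>f x\<bar> \<le> (\<delta> + c) \<parallel>x\<parallel>\<close> for all \<open>x\<close>
  (\<open>slice_pointwise_estimate\<close>): either \<open>x\<close> is, up to sign and scaling, in the slice and hence close
  to \<open>x\<^sub>0\<close>, or \<open>\<bar>f x\<bar>\<close> falls short of \<open>\<parallel>x\<parallel>\<close> by so much that the second summand pays for the first.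

  This inequality survives tensoring with \<open>Y\<close>.  Let \<open>P (x \<otimes> y) = f x y\<close> map the tensor product to
  \<open>Y\<close> and let \<open>J y = x\<^sub>0 \<otimes> y\<close> map it back.  The projective norm is the largest seminorm bounded by
  \<open>\<parallel>x\<parallel> \<parallel>y\<parallel>\<close> on elementary tensors (\<open>subadditive_le_proj_norm\<close>), so it suffices to test on those to
  obtain \<open>\<parallel>u - J (P u)\<parallel> + c \<parallel>P u\<parallel> \<le> (\<delta> + c) \<parallel>u\<parallel>\<close> for all \<open>u\<close>, first on the algebraic tensor product
  and then, by density, on its completion (\<open>projective_tensor_almost_projection\<close>).

  Hence every \<open>u\<close> in the ball for which \<open>\<parallel>P u\<parallel>\<close> is nearly 1 is nearly equal to \<open>J (P u)\<close>.  Pulling the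
  slices of a small convex combination in \<open>Y\<close> back along \<open>P\<close>, and making them thinner, gives slices
  that \<open>P\<close> maps into the given ones and on which \<open>J \<circ> P\<close> is nearly the identity; their convex
  combination is therefore nearly as small as the one in \<open>Y\<close> (\<open>BSCSP_transfer\<close>).\<close>

section \<open>Slices\<close>

lemma functional_exceeds_in_ball:
  fixes f :: "'a::real_normed_vector \<Rightarrow>\<^sub>L real"
  assumes "r < norm f" "0 \<le> r"
  obtains x where "norm x \<le> 1" "r < f x"
proof (rule ccontr)
  assume "\<not> thesis"
  then have le: "f x \<le> r" if "norm x \<le> 1" for x using that \<open>\<And>x. _ \<Longrightarrow> _ \<Longrightarrow> thesis\<close> by force
  have "norm (f x) \<le> r * norm x" for x
  proof (cases "x = 0")
    case False
    have "f (x /\<^sub>R norm x) \<le> r" "f (- (x /\<^sub>R norm x)) \<le> r" using False by (auto intro!: le)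
    then show ?thesis
      using False by (auto simp: blinfun.scaleR_right blinfun.minus_right field_simps abs_le_iff)
  qed simp
  then have "norm f \<le> r" using assms(2) by (intro norm_blinfun_bound) auto
  then show False using assms(1) by simp
qed

text \<open>The constant \<open>2 / \<alpha>\<close> is chosen for the points outside the cone over the slice: there \<open>\<bar>f x\<bar>\<close>
  is smaller than \<open>\<parallel>x\<parallel>\<close> by at least \<open>\<alpha> \<parallel>x\<parallel>\<close>, which balances the crude bound \<open>2 \<parallel>x\<parallel>\<close> on the
  first summand.\<close>

lemma slice_pointwise_estimate:
  fixes f :: "'a::real_normed_vector \<Rightarrow>\<^sub>L real"
  assumes f: "norm f = 1" and \<alpha>: "0 < \<alpha>" "\<alpha> < 1"
    and x\<^sub>0: "norm x\<^sub>0 \<le> 1"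
    and near: "\<And>x. norm x \<le> 1 \<Longrightarrow> 1 - \<alpha> < f x \<Longrightarrow> norm (x - x\<^sub>0) \<le> \<delta>" and \<delta>: "0 \<le> \<delta>"
  shows "norm (x - f x *\<^sub>R x\<^sub>0) + 2 / \<alpha> * \<bar>f x\<bar> \<le> (\<delta> + 2 / \<alpha>) * norm x"
proof -
  have pos: "norm (x - f x *\<^sub>R x\<^sub>0) \<le> \<delta> * norm x + 2 / \<alpha> * (norm x - f x)" if fx: "0 \<le> f x" for x
  proof (cases "(1 - \<alpha>) * norm x < f x")
    case True
    have gap: "f x \<le> norm x" using norm_blinfun[of f x] f by simp
    have x: "0 < norm x" using True fx by (cases "x = 0") auto
    have "norm (x /\<^sub>R norm x - x\<^sub>0) \<le> \<delta>"
      using True x by (intro near) (auto simp: blinfun.scaleR_right field_simps)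
    then have "norm x * norm (x /\<^sub>R norm x - x\<^sub>0) \<le> norm x * \<delta>" by (rule mult_left_mono) simp
    also have "norm x * norm (x /\<^sub>R norm x - x\<^sub>0) = norm (norm x *\<^sub>R (x /\<^sub>R norm x - x\<^sub>0))" by simp
    also have "norm x *\<^sub>R (x /\<^sub>R norm x - x\<^sub>0) = x - norm x *\<^sub>R x\<^sub>0"
      using x by (simp add: scaleR_diff_right)
    finally have 1: "norm (x - norm x *\<^sub>R x\<^sub>0) \<le> \<delta> * norm x" by (simp add: mult.commute)
    have "norm ((norm x - f x) *\<^sub>R x\<^sub>0) \<le> (norm x - f x) * 1"
      unfolding norm_scaleR using gap x\<^sub>0 by (intro mult_mono) auto
    also have "\<dots> \<le> (norm x - f x) * (2 / \<alpha>)" using gap \<alpha> by (intro mult_left_mono) auto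
    finally have 2: "norm ((norm x - f x) *\<^sub>R x\<^sub>0) \<le> 2 / \<alpha> * (norm x - f x)" by (simp add: mult.commute)
    have "x - f x *\<^sub>R x\<^sub>0 = (x - norm x *\<^sub>R x\<^sub>0) + (norm x - f x) *\<^sub>R x\<^sub>0"
      by (simp add: algebra_simps)
    then have "norm (x - f x *\<^sub>R x\<^sub>0) \<le> norm (x - norm x *\<^sub>R x\<^sub>0) + norm ((norm x - f x) *\<^sub>R x\<^sub>0)"
      by (simp only: norm_triangle_ineq)
    then show ?thesis using 1 2 by linarith
  next
    case False
    have "norm (f x *\<^sub>R x\<^sub>0) \<le> f x * 1" unfolding norm_scaleR using fx x\<^sub>0 by (intro mult_mono) auto
    moreover have "f x \<le> norm x" using norm_blinfun[of f x] f by simp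
    ultimately have "norm (x - f x *\<^sub>R x\<^sub>0) \<le> 2 * norm x"
      using norm_triangle_ineq4[of x "f x *\<^sub>R x\<^sub>0"] by linarith
    also have "\<dots> = 2 / \<alpha> * (\<alpha> * norm x)" using \<alpha> by simp
    also have "\<dots> \<le> 2 / \<alpha> * (norm x - f x)"
      using False \<alpha> by (intro mult_left_mono) (auto simp: algebra_simps)
    also have "\<dots> \<le> \<delta> * norm x + 2 / \<alpha> * (norm x - f x)" using \<delta> by simp
    finally show ?thesis .
  qed
  show ?thesis
  proof (cases "0 \<le> f x")
    case True
    then show ?thesis using pos[of x] by (simp add: algebra_simps)
  next
    case False
    have "norm (- x - f (- x) *\<^sub>R x\<^sub>0) = norm (x - f x *\<^sub>R x\<^sub>0)"
      using norm_minus_cancel[of "x - f x *\<^sub>R x\<^sub>0"] by (simp add: blinfun.minus_right)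
    then show ?thesis using pos[of "- x"] False by (simp add: blinfun.minus_right algebra_simps)
  qed
qed

section \<open>Extension of operators to the completion\<close>

lemma completion_closed_induct:
  assumes "closed {u. Q u}" "\<And>z. Q (to_completion z)"
  shows "Q u"
  using closure_minimal[of "range to_completion" "{u. Q u}"] assms
  by (auto simp: closure_range_to_completion)

lemma completion_sequence:
  fixes u :: "'a::real_normed_vector completion"
  obtains z where "(\<lambda>n. to_completion (z n)) \<longlonglongrightarrow> u"
proof -
  have "u \<in> closure (range to_completion)" by (simp add: closure_range_to_completion)
  then obtain v where v: "\<And>n. v n \<in> range (to_completion :: 'a \<Rightarrow> _)" and vu: "v \<longlonglongrightarrow> u"
    by (auto simp: closure_sequential)
  from v have "\<forall>n. \<exists>w. v n = to_completion w" by blast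
  from choice[OF this] obtain w where "\<forall>n. v n = to_completion (w n)" ..
  then have "v = (\<lambda>n. to_completion (w n))" by (intro HOL.ext) (rule spec)
  then show ?thesis using vu that[of w] by (simp only:)
qed

text \<open>Along every sequence from the dense subspace that converges to \<open>u\<close> the values of \<open>A\<close> are
  Cauchy, and their limit is independent of the sequence because \<open>A\<close> maps null sequences to null
  sequences; that limit is the value of the extension at \<open>u\<close>.\<close>

lemma completion_extension:
  fixes A :: "'a::real_normed_vector \<Rightarrow>\<^sub>L 'b::banach"
  obtains E :: "'a completion \<Rightarrow>\<^sub>L 'b"
  where "\<And>z. E (to_completion z) = A z" "norm E \<le> norm A"
proof -
  have iso: "norm (to_completion z - to_completion w) = norm (z - w)" for z w :: 'a
    by (simp flip: linear_diff[OF linear_to_completion])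
  have "\<exists>y. \<forall>z. (\<lambda>n. to_completion (z n)) \<longlonglongrightarrow> u \<longrightarrow> (\<lambda>n. A (z n)) \<longlonglongrightarrow> y" for u :: "'a completion"
  proof -
    obtain w where w: "(\<lambda>n. to_completion (w n)) \<longlonglongrightarrow> u" by (rule completion_sequence)
    have "Cauchy w" using LIMSEQ_imp_Cauchy[OF w] by (simp add: Cauchy_def dist_norm iso)
    then have "Cauchy (\<lambda>n. A (w n))" by (rule bounded_linear.Cauchy[OF blinfun.bounded_linear_right])
    then obtain y where y: "(\<lambda>n. A (w n)) \<longlonglongrightarrow> y" by (auto simp: Cauchy_convergent_iff convergent_def)
    have "(\<lambda>n. A (z n)) \<longlonglongrightarrow> y" if z: "(\<lambda>n. to_completion (z n)) \<longlonglongrightarrow> u" for z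
    proof -
      have "(\<lambda>n. to_completion (z n) - to_completion (w n)) \<longlonglongrightarrow> 0" using tendsto_diff[OF z w] by simp
      then have "(\<lambda>n. z n - w n) \<longlonglongrightarrow> 0"
        unfolding tendsto_norm_zero_iff[symmetric, of "\<lambda>n. _ n - _ n"] iso .
      then have "(\<lambda>n. A (z n - w n)) \<longlonglongrightarrow> A 0" by (rule blinfun.tendsto[OF tendsto_const])
      then have "(\<lambda>n. A (z n - w n) + A (w n)) \<longlonglongrightarrow> A 0 + y" using y by (rule tendsto_add)
      then show ?thesis by (simp add: blinfun.diff_right)
    qed
    then show ?thesis by blast
  qed
  then obtain E where E: "\<And>u z. (\<lambda>n. to_completion (z n)) \<longlonglongrightarrow> u \<Longrightarrow> (\<lambda>n. A (z n)) \<longlonglongrightarrow> E u" by metis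
  have ext: "E (to_completion z) = A z" for z
    using E[of "\<lambda>_. z" "to_completion z"] by (simp add: LIMSEQ_const_iff)
  have E_le: "norm (E u) \<le> norm A * norm u" for u
  proof -
    obtain z where z: "(\<lambda>n. to_completion (z n)) \<longlonglongrightarrow> u" by (rule completion_sequence)
    have le: "norm (A (z n)) \<le> norm A * norm (to_completion (z n))" for n
      using norm_blinfun[of A "z n"] by simp
    show ?thesis
    proof (rule LIMSEQ_le)
      show "(\<lambda>n. norm (A (z n))) \<longlonglongrightarrow> norm (E u)" by (intro tendsto_norm E z)
      show "(\<lambda>n. norm A * norm (to_completion (z n))) \<longlonglongrightarrow> norm A * norm u"
        by (intro tendsto_mult tendsto_const tendsto_norm z)
    qed (use le in blast)
  qed
  have bl: "bounded_linear E"
  proof (rule bounded_linear_intro)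
    fix u v :: "'a completion" and c :: real
    obtain z where z: "(\<lambda>n. to_completion (z n)) \<longlonglongrightarrow> u" by (rule completion_sequence)
    obtain w where w: "(\<lambda>n. to_completion (w n)) \<longlonglongrightarrow> v" by (rule completion_sequence)
    show "E (u + v) = E u + E v"
    proof (rule LIMSEQ_unique)
      show "(\<lambda>n. A (z n + w n)) \<longlonglongrightarrow> E (u + v)"
        using tendsto_add[OF z w] by (intro E) (simp add: linear_add[OF linear_to_completion])
      show "(\<lambda>n. A (z n + w n)) \<longlonglongrightarrow> E u + E v"
        unfolding blinfun.add_right by (intro tendsto_add E z w)
    qed
    show "E (c *\<^sub>R u) = c *\<^sub>R E u"
    proof (rule LIMSEQ_unique)
      show "(\<lambda>n. A (c *\<^sub>R z n)) \<longlonglongrightarrow> E (c *\<^sub>R u)"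
        using tendsto_scaleR[OF tendsto_const z] by (intro E) (simp add: linear_scale[OF linear_to_completion])
      show "(\<lambda>n. A (c *\<^sub>R z n)) \<longlonglongrightarrow> c *\<^sub>R E u"
        unfolding blinfun.scaleR_right by (intro tendsto_scaleR tendsto_const E z)
    qed
    show "norm (E u) \<le> norm u * norm A" using E_le[of u] by (simp add: mult.commute)
  qed
  have app: "blinfun_apply (Blinfun E) = E" by (rule bounded_linear_Blinfun_apply[OF bl])
  show ?thesis
  proof (rule that[of "Blinfun E"])
    show "Blinfun E (to_completion z) = A z" for z unfolding app by (rule ext)
    show "norm (Blinfun E) \<le> norm A"
      by (rule norm_blinfun_bound) (simp_all only: app norm_ge_zero E_le)
  qed
qed

section \<open>The projective norm as the largest cross-seminorm\<close>

lemma subadditive_le_proj_norm: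
  fixes N :: "('a::real_normed_vector, 'b::real_normed_vector) alg_tensor \<Rightarrow> real"
  assumes "N 0 \<le> 0" and "\<And>u v. N (u + v) \<le> N u + N v"
    and "0 < K" and "\<And>x y. N (x \<otimes>\<^sub>t y) \<le> K * (norm x * norm y)"
  shows "N u \<le> K * norm u"
proof -
  have "N (\<Sum>(x, y)\<leftarrow>us. x \<otimes>\<^sub>t y) \<le> K * proj_cost us" for us
  proof (induction us)
    case Nil
    then show ?case using assms(1) by (simp add: proj_cost_def)
  next
    case (Cons p us)
    obtain x y where p: "p = (x, y)" by fastforce
    show ?case
      using Cons assms(2)[of "x \<otimes>\<^sub>t y" "\<Sum>(x, y)\<leftarrow>us. x \<otimes>\<^sub>t y"] assms(4)[of x y]
      by (simp add: p proj_cost_def algebra_simps)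
  qed
  then have "N u / K \<le> proj_norm u"
    using assms(3) by (intro proj_norm_ge) (simp add: field_simps)
  then show ?thesis using assms(3) by (simp add: norm_alg_tensor_def field_simps)
qed

lemma norm_tensor_le: "norm (x \<otimes>\<^sub>t y) \<le> norm x * norm y"
  using proj_norm_le[of "x \<otimes>\<^sub>t y" "[(x, y)]"] by (simp add: norm_alg_tensor_def proj_cost_def)

lemma bounded_bilinear_lift:
  fixes B :: "'a::real_normed_vector \<Rightarrow> 'b::real_normed_vector \<Rightarrow> 'c::real_normed_vector"
  assumes "bilinear B" and "0 < K" and "\<And>x y. norm (B x y) \<le> K * (norm x * norm y)"
  obtains L :: "('a, 'b) alg_tensor \<Rightarrow>\<^sub>L 'c"
  where "\<And>x y. L (x \<otimes>\<^sub>t y) = B x y" "norm L \<le> K"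
proof -
  obtain L where L: "linear L" "\<And>x y. L (x \<otimes>\<^sub>t y) = B x y"
    using alg_tensor_universal[OF assms(1)] by blast
  have bound: "norm (L u) \<le> K * norm u" for u
    by (rule subadditive_le_proj_norm)
      (auto simp: L assms linear_0[OF L(1)] linear_add[OF L(1)] norm_triangle_ineq)
  have bl: "bounded_linear L"
    using bound by (intro bounded_linear_intro[of L K])
      (auto simp: linear_add[OF L(1)] linear_scale[OF L(1)] mult.commute)
  show ?thesis
    using assms(2) bound by (intro that[of "Blinfun L"])
      (auto simp: bounded_linear_Blinfun_apply[OF bl] L intro!: norm_blinfun_bound)
qed

text \<open>The function \<open>u \<mapsto> \<parallel>u - J (P u)\<parallel> + c \<parallel>P u\<parallel>\<close> is a seminorm, and on \<open>x \<otimes> y\<close> it is at most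
  \<open>(\<parallel>x - f x x\<^sub>0\<parallel> + c \<bar>f x\<bar>) \<parallel>y\<parallel>\<close>; so the assumed inequality on \<open>X\<close> is all that has to be known.\<close>

lemma projective_tensor_almost_projection:
  fixes f :: "'a::real_normed_vector \<Rightarrow>\<^sub>L real"
  assumes f: "norm f = 1" and x\<^sub>0: "norm x\<^sub>0 \<le> 1" and c: "0 \<le> c" and K: "0 < K"
    and est: "\<And>x. norm (x - f x *\<^sub>R x\<^sub>0) + c * \<bar>f x\<bar> \<le> K * norm x"
  obtains P :: "('a, 'b::banach) projective_tensor \<Rightarrow>\<^sub>L 'b"
    and J :: "'b \<Rightarrow>\<^sub>L ('a, 'b) projective_tensor"
  where "norm P \<le> 1" "norm J \<le> 1"
    "\<And>x y. P (to_completion (x \<otimes>\<^sub>t y)) = f x *\<^sub>R y"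
    "\<And>u. norm (u - J (P u)) + c * norm (P u) \<le> K * norm u"
proof -
  have "bilinear (\<lambda>x (y::'b). f x *\<^sub>R y)"
    unfolding bilinear_def
    by (intro conjI allI linearI) (auto simp: blinfun.bilinear_simps algebra_simps)
  moreover have "norm (f x *\<^sub>R y) \<le> 1 * (norm x * norm y)" for x and y :: 'b
    using mult_right_mono[OF norm_blinfun[of f x], of "norm y"] f by simp
  ultimately obtain L :: "('a, 'b) alg_tensor \<Rightarrow>\<^sub>L 'b"
    where L: "\<And>x y. L (x \<otimes>\<^sub>t y) = f x *\<^sub>R y" "norm L \<le> 1"
    using bounded_bilinear_lift[of "\<lambda>x (y::'b). f x *\<^sub>R y" 1] by force
  obtain P :: "('a, 'b) projective_tensor \<Rightarrow>\<^sub>L 'b"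
    where P: "\<And>z. P (to_completion z) = L z" "norm P \<le> norm L"
    using completion_extension[of L] by blast
  define j where "j y = to_completion (x\<^sub>0 \<otimes>\<^sub>t y)" for y :: 'b
  have j_norm: "norm (j y) \<le> norm y" for y
    using norm_tensor_le[of x\<^sub>0 y] mult_right_mono[OF x\<^sub>0, of "norm y"] by (simp add: j_def)
  have bl: "bounded_linear j"
    using j_norm by (intro bounded_linear_intro[of j 1])
      (auto simp: j_def bilinear_radd[OF bilinear_tensor] bilinear_rmul[OF bilinear_tensor]
        linear_add[OF linear_to_completion] linear_scale[OF linear_to_completion])
  define J where "J = Blinfun j"
  have J: "J y = to_completion (x\<^sub>0 \<otimes>\<^sub>t y)" for y
    by (simp add: J_def bounded_linear_Blinfun_apply[OF bl] j_def)
  have norm_J: "norm J \<le> 1"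
    using j_norm by (intro norm_blinfun_bound) (auto simp: J j_def)
  define N where "N z = norm (z - x\<^sub>0 \<otimes>\<^sub>t L z) + c * norm (L z)" for z :: "('a, 'b) alg_tensor"
  have "N z \<le> K * norm z" for z
  proof (rule subadditive_le_proj_norm[OF _ _ K])
    show "N 0 \<le> 0" by (simp add: N_def bilinear_rzero[OF bilinear_tensor])
    show "N (u + v) \<le> N u + N v" for u v
    proof -
      have "u + v - x\<^sub>0 \<otimes>\<^sub>t L (u + v) = (u - x\<^sub>0 \<otimes>\<^sub>t L u) + (v - x\<^sub>0 \<otimes>\<^sub>t L v)"
        by (simp add: blinfun.add_right bilinear_radd[OF bilinear_tensor])
      then have "norm (u + v - x\<^sub>0 \<otimes>\<^sub>t L (u + v)) \<le> norm (u - x\<^sub>0 \<otimes>\<^sub>t L u) + norm (v - x\<^sub>0 \<otimes>\<^sub>t L v)"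
        by (simp only: norm_triangle_ineq)
      moreover have "c * norm (L (u + v)) \<le> c * (norm (L u) + norm (L v))"
        unfolding blinfun.add_right using c by (intro mult_left_mono norm_triangle_ineq)
      ultimately show ?thesis by (simp add: N_def algebra_simps)
    qed
    show "N (x \<otimes>\<^sub>t y) \<le> K * (norm x * norm y)" for x y
    proof -
      have "x \<otimes>\<^sub>t y - x\<^sub>0 \<otimes>\<^sub>t L (x \<otimes>\<^sub>t y) = (x - f x *\<^sub>R x\<^sub>0) \<otimes>\<^sub>t y"
        by (simp add: L bilinear_lsub[OF bilinear_tensor] bilinear_lmul[OF bilinear_tensor]
            bilinear_rmul[OF bilinear_tensor])
      then have "N (x \<otimes>\<^sub>t y) = norm ((x - f x *\<^sub>R x\<^sub>0) \<otimes>\<^sub>t y) + c * norm (L (x \<otimes>\<^sub>t y))"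
        by (simp only: N_def)
      also have "\<dots> \<le> (norm (x - f x *\<^sub>R x\<^sub>0) + c * \<bar>f x\<bar>) * norm y"
        using norm_tensor_le[of "x - f x *\<^sub>R x\<^sub>0" y] by (simp add: L distrib_right)
      also have "\<dots> \<le> K * norm x * norm y" by (intro mult_right_mono est) simp
      finally show ?thesis by (simp add: mult.assoc)
    qed
  qed
  then have dense: "norm (to_completion z - J (P (to_completion z))) + c * norm (P (to_completion z))
      \<le> K * norm (to_completion z)" for z
    by (simp add: P J N_def flip: linear_diff[OF linear_to_completion])
  have "norm (u - J (P u)) + c * norm (P u) \<le> K * norm u" for u
  proof (rule completion_closed_induct)
    show "closed {u. norm (u - J (P u)) + c * norm (P u) \<le> K * norm u}"
      by (intro closed_Collect_le continuous_intros)
  qed (rule dense)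
  then show ?thesis
    using P L norm_J by (intro that[of P J]) auto
qed

section \<open>Transfer of small combinations of slices\<close>

text \<open>A slice of \<open>Z\<close> is the pullback of a slice of \<open>Y\<close> along \<open>P\<close>, with a width so small that
  \<open>\<parallel>P u\<parallel> > 1 - \<delta> / c\<close> on it; the last assumption then gives \<open>\<parallel>u - J (P u)\<parallel> \<le> 2 \<delta>\<close>.\<close>

lemma BSCSP_transfer:
  assumes Y: "BSCSP TYPE('b::banach)"
    and proj: "\<And>\<delta>::real. 0 < \<delta> \<Longrightarrow> \<exists>(P :: 'z::banach \<Rightarrow>\<^sub>L 'b) (J :: 'b \<Rightarrow>\<^sub>L 'z) c. 0 < c \<and>
      norm P \<le> 1 \<and> norm J \<le> 1 \<and>
      (\<forall>g :: 'b \<Rightarrow>\<^sub>L real. norm g \<le> norm (g o\<^sub>L P)) \<and>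
      (\<forall>u. norm (u - blinfun_apply J (P u)) + c * norm (P u) \<le> (\<delta> + c) * norm u)"
  shows "BSCSP TYPE('z)"
  unfolding BSCSP_def
proof (intro allI impI)
  fix \<epsilon> :: real assume \<epsilon>: "0 < \<epsilon>"
  \<comment> \<open>Two points of the new combination are \<open>2 \<delta>\<close>-close to images under \<open>J\<close> of points of the old one,
    which are \<open>\<delta>\<close>-close to each other: \<open>2 \<delta> + \<delta> + 2 \<delta> < \<epsilon>\<close>.\<close>
  define \<delta> where "\<delta> = \<epsilon> / 6"
  have \<delta>: "0 < \<delta>" using \<epsilon> by (simp add: \<delta>_def)
  obtain P :: "'z \<Rightarrow>\<^sub>L 'b" and J :: "'b \<Rightarrow>\<^sub>L 'z" and c where c: "0 < c"
    and P1: "norm P \<le> 1" and J1: "norm J \<le> 1"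
    and pull: "\<And>g :: 'b \<Rightarrow>\<^sub>L real. norm g \<le> norm (g o\<^sub>L P)"
    and est: "\<And>u. norm (u - J (P u)) + c * norm (P u) \<le> (\<delta> + c) * norm u"
    using proj[OF \<delta>] by blast
  obtain n and S :: "nat \<Rightarrow> 'b set" and l where S: "\<And>i. i < n \<Longrightarrow> is_slice (S i)"
    and l: "\<And>i. i < n \<Longrightarrow> 0 \<le> l i" "(\<Sum>i<n. l i) = 1"
    and diam: "diameter {\<Sum>i<n. l i *\<^sub>R z i |z. \<forall>i<n. z i \<in> S i} < \<delta>"
    using Y \<delta> unfolding BSCSP_def by blast
  have P_le: "norm (P u) \<le> norm u" for u
    using norm_blinfun[of P u] mult_right_mono[OF P1, of "norm u"] by simp
  have J_le: "norm (J v) \<le> norm v" for v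
    using norm_blinfun[of J v] mult_right_mono[OF J1, of "norm v"] by simp
  have "\<exists>T. is_slice T \<and> (\<forall>u\<in>T. P u \<in> S i \<and> norm (u - J (P u)) \<le> 2 * \<delta>)" if i: "i < n" for i
  proof -
    obtain g :: "'b \<Rightarrow>\<^sub>L real" and \<beta> where g: "norm g = 1" and \<beta>: "0 < \<beta>" "\<beta> < 1"
      and Si: "S i = {z \<in> cball 0 1. g z > 1 - \<beta>}"
      using S[OF i] unfolding is_slice_def by blast
    define \<gamma> where "\<gamma> = min \<beta> (\<delta> / c)"
    define T where "T = {u \<in> cball 0 1. (g o\<^sub>L P) u > 1 - \<gamma>}"
    have "norm (g o\<^sub>L P) \<le> norm g * norm P" by (rule norm_blinfun_compose)
    then have "norm (g o\<^sub>L P) = 1" using pull[of g] P1 g by simp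
    moreover have "0 < \<gamma>" "\<gamma> < 1" using \<beta> \<delta> c by (auto simp: \<gamma>_def)
    ultimately have "is_slice T" unfolding is_slice_def T_def by blast
    moreover have "P u \<in> S i \<and> norm (u - J (P u)) \<le> 2 * \<delta>" if "u \<in> T" for u
    proof
      have u: "norm u \<le> 1" and gu: "1 - \<gamma> < g (P u)" using that by (auto simp: T_def)
      show "P u \<in> S i" using u gu P_le[of u] by (auto simp: Si \<gamma>_def)
      have "g (P u) \<le> norm (P u)" using norm_blinfun[of g "P u"] g by simp
      then have "1 - \<delta> / c < norm (P u)" using gu by (simp add: \<gamma>_def)
      then have "c - \<delta> \<le> c * norm (P u)" using c by (simp add: field_simps)
      moreover have "norm (u - J (P u)) + c * norm (P u) \<le> \<delta> + c"
        using u \<delta> c by (intro order.trans[OF est mult_left_le]) auto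
      ultimately show "norm (u - J (P u)) \<le> 2 * \<delta>" by linarith
    qed
    ultimately show ?thesis by blast
  qed
  then obtain T where T: "\<And>i. i < n \<Longrightarrow> is_slice (T i)"
    and TP: "\<And>i u. i < n \<Longrightarrow> u \<in> T i \<Longrightarrow> P u \<in> S i"
    and TJ: "\<And>i u. i < n \<Longrightarrow> u \<in> T i \<Longrightarrow> norm (u - J (P u)) \<le> 2 * \<delta>" by metis
  define C where "C = {\<Sum>i<n. l i *\<^sub>R z i |z. \<forall>i<n. z i \<in> S i}"
  have "bounded C"
    unfolding bounded_iff
  proof (intro exI ballI)
    fix v assume "v \<in> C"
    then obtain z where z: "\<And>i. i < n \<Longrightarrow> z i \<in> S i" and v: "v = (\<Sum>i<n. l i *\<^sub>R z i)" by (auto simp: C_def)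
    have "norm (z i) \<le> 1" if "i < n" for i using z[OF that] S[OF that] by (auto simp: is_slice_def)
    then have "norm v \<le> (\<Sum>i<n. l i * 1)"
      unfolding v using l(1) by (intro sum_norm_le) (auto intro: mult_left_le)
    then show "norm v \<le> 1" using l(2) by simp
  qed
  have near: "norm ((\<Sum>i<n. l i *\<^sub>R u i) - J (\<Sum>i<n. l i *\<^sub>R P (u i))) \<le> 2 * \<delta>"
    if "\<forall>i<n. u i \<in> T i" for u
  proof -
    have "(\<Sum>i<n. l i *\<^sub>R u i) - J (\<Sum>i<n. l i *\<^sub>R P (u i)) = (\<Sum>i<n. l i *\<^sub>R (u i - J (P (u i))))"
      by (simp add: blinfun.sum_right blinfun.scaleR_right scaleR_diff_right sum_subtractf)
    also have "norm \<dots> \<le> (\<Sum>i<n. l i * (2 * \<delta>))"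
      using l(1) that by (intro sum_norm_le) (auto intro!: mult_left_mono TJ)
    also have "\<dots> = 2 * \<delta>" using l(2) by (simp flip: sum_distrib_right)
    finally show ?thesis .
  qed
  have "norm ((\<Sum>i<n. l i *\<^sub>R u i) - (\<Sum>i<n. l i *\<^sub>R v i)) \<le> 5 * \<delta>"
    if u: "\<forall>i<n. u i \<in> T i" and v: "\<forall>i<n. v i \<in> T i" for u v
  proof -
    define a b where "a = (\<Sum>i<n. l i *\<^sub>R P (u i))" and "b = (\<Sum>i<n. l i *\<^sub>R P (v i))"
    have "a \<in> C" unfolding a_def C_def mem_Collect_eq
      using TP u by (intro exI[of _ "\<lambda>i. P (u i)"]) simp
    moreover have "b \<in> C" unfolding b_def C_def mem_Collect_eq
      using TP v by (intro exI[of _ "\<lambda>i. P (v i)"]) simp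
    ultimately have "dist a b \<le> diameter C" using \<open>bounded C\<close> by (intro diameter_bounded_bound)
    then have "norm (a - b) \<le> \<delta>" using diam by (simp add: C_def dist_norm)
    then have "norm (J a - J b) \<le> \<delta>" using J_le[of "a - b"] by (simp add: blinfun.diff_right)
    moreover have "norm ((\<Sum>i<n. l i *\<^sub>R u i) - J a) \<le> 2 * \<delta>" unfolding a_def by (rule near[OF u])
    moreover have "norm (J b - (\<Sum>i<n. l i *\<^sub>R v i)) \<le> 2 * \<delta>"
      unfolding b_def by (subst norm_minus_commute) (rule near[OF v])
    ultimately have "norm ((\<Sum>i<n. l i *\<^sub>R u i) - (\<Sum>i<n. l i *\<^sub>R v i)) \<le> 2 * \<delta> + (\<delta> + 2 * \<delta>)"
      by (intro norm_diff_triangle_le)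
    then show ?thesis by simp
  qed
  then have "diameter {\<Sum>i<n. l i *\<^sub>R u i |u. \<forall>i<n. u i \<in> T i} \<le> 5 * \<delta>"
    using \<delta> by (intro diameter_le) auto
  also have "\<dots> < \<epsilon>" using \<epsilon> by (simp add: \<delta>_def)
  finally show "\<exists>(n::nat) (S :: nat \<Rightarrow> 'z set) (l :: nat \<Rightarrow> real).
     (\<forall>i<n. is_slice (S i)) \<and> (\<forall>i<n. 0 \<le> l i) \<and> (\<Sum>i<n. l i) = 1 \<and>
     diameter {\<Sum>i<n. l i *\<^sub>R z i |z. \<forall>i<n. z i \<in> S i} < \<epsilon>"
    using T l by blast
qed

theorem corollary2p13:
  assumes "BDP TYPE('a::banach)"
    and "BSCSP TYPE('b::banach)"
  shows "BSCSP TYPE(('a, 'b) projective_tensor)"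
proof (rule BSCSP_transfer[OF assms(2)])
  fix \<delta> :: real assume \<delta>: "0 < \<delta>"
  obtain S :: "'a set" where "is_slice S" and diam: "diameter S < \<delta>"
    using assms(1) \<delta> unfolding BDP_def by blast
  then obtain f :: "'a \<Rightarrow>\<^sub>L real" and \<alpha> where f: "norm f = 1" and \<alpha>: "0 < \<alpha>" "\<alpha> < 1"
    and S: "S = {z \<in> cball 0 1. f z > 1 - \<alpha>}"
    unfolding is_slice_def by blast
  obtain x\<^sub>0 where x\<^sub>0: "norm x\<^sub>0 \<le> 1" "1 - \<alpha> < f x\<^sub>0"
    using functional_exceeds_in_ball[of "1 - \<alpha>" f] f \<alpha> by auto
  have "bounded S" unfolding S by (rule bounded_subset[OF bounded_cball[of 0 1]]) auto
  have near: "norm (x - x\<^sub>0) \<le> \<delta>" if "norm x \<le> 1" "1 - \<alpha> < f x" for x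
    using diameter_bounded_bound[OF \<open>bounded S\<close>, of x x\<^sub>0] that x\<^sub>0 diam by (simp add: S dist_norm)
  have c: "0 \<le> 2 / \<alpha>" "0 < \<delta> + 2 / \<alpha>" using \<alpha> \<delta> by (auto intro: add_pos_pos)
  have est_X: "norm (x - f x *\<^sub>R x\<^sub>0) + 2 / \<alpha> * \<bar>f x\<bar> \<le> (\<delta> + 2 / \<alpha>) * norm x" for x
    by (rule slice_pointwise_estimate[OF f \<alpha> x\<^sub>0(1) near less_imp_le[OF \<delta>]])
  obtain P :: "('a, 'b) projective_tensor \<Rightarrow>\<^sub>L 'b" and J
    where P: "norm P \<le> 1" and J: "norm J \<le> 1"
      and elem: "\<And>x y. P (to_completion (x \<otimes>\<^sub>t y)) = f x *\<^sub>R y"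
      and est: "\<And>u. norm (u - blinfun_apply J (P u)) + 2 / \<alpha> * norm (P u) \<le> (\<delta> + 2 / \<alpha>) * norm u"
    using projective_tensor_almost_projection[OF f x\<^sub>0(1) c est_X] by blast
  \<comment> \<open>Tested on elementary tensors, \<open>g \<circ> P\<close> is \<open>f \<otimes> g\<close>, whose norm is at least \<open>\<parallel>f\<parallel> \<parallel>g\<parallel>\<close>: fix \<open>y\<close> and
    let \<open>x\<close> vary, then let \<open>y\<close> vary.\<close>
  have pull: "norm g \<le> norm (g o\<^sub>L P)" for g :: "'b \<Rightarrow>\<^sub>L real"
  proof (rule norm_blinfun_bound)
    fix y
    have "norm (g y *\<^sub>R f) \<le> norm (g o\<^sub>L P) * norm y"
    proof (rule norm_blinfun_bound)
      fix x
      have "norm ((g y *\<^sub>R f) x) = norm ((g o\<^sub>L P) (to_completion (x \<otimes>\<^sub>t y)))"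
        by (simp add: elem blinfun.bilinear_simps mult.commute)
      also have "\<dots> \<le> norm (g o\<^sub>L P) * norm (x \<otimes>\<^sub>t y)"
        using norm_blinfun[of "g o\<^sub>L P" "to_completion (x \<otimes>\<^sub>t y)"] by simp
      also have "\<dots> \<le> norm (g o\<^sub>L P) * (norm x * norm y)" by (intro mult_left_mono norm_tensor_le) simp
      finally show "norm ((g y *\<^sub>R f) x) \<le> norm (g o\<^sub>L P) * norm y * norm x" by (simp add: mult_ac)
    qed simp
    then show "norm (g y) \<le> norm (g o\<^sub>L P) * norm y" using f by simp
  qed simp
  have "0 < 2 / \<alpha>" using \<alpha> by simp
  then show "\<exists>(P :: ('a, 'b) projective_tensor \<Rightarrow>\<^sub>L 'b) (J :: 'b \<Rightarrow>\<^sub>L ('a, 'b) projective_tensor) c. 0 < c \<and>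
      norm P \<le> 1 \<and> norm J \<le> 1 \<and>
      (\<forall>g :: 'b \<Rightarrow>\<^sub>L real. norm g \<le> norm (g o\<^sub>L P)) \<and>
      (\<forall>u. norm (u - blinfun_apply J (P u)) + c * norm (P u) \<le> (\<delta> + c) * norm u)"
    using P J pull est by (intro exI[of _ P] exI[of _ J] exI[of _ "2 / \<alpha>"]) blast
qed

end
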